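(* Let $J$ be a finite-dimensional complex Jordan algebra with unity $e$ and, for $i=1,2$, let $M_i$ be a (not necessarily unital) Jordan algebra together with a bilinear product $J\times M_i\to M_i$, $(x,m_i)\mapsto x\cdot m_i$, such that $J_i=J\oplus M_i$ with the product $(x,m_i)\cdot(x',m_i')=(xx',\,x\cdot m_i'+x'\cdot m_i+m_im_i')$ is a (finite-dimensional) Jordan algebra with unity $(e,0)$. Assume that $J_1$ and $J_2$ have the same rank $r$, and that there is a norm $N\in \mathrm{Sym}^r(J^* )$ on $J$ such that $N(x)=N_1(x,m_1)=N_2(x,m_2)$ for every $(x,m_1,m_2)\in J\times M_1\times M_2$, where $N_i\in\mathrm{Sym}^r(J_i^* )$ is the generic norm of $J_i$. Let $J(M_1,M_2)=J\oplus M_1\oplus M_2$ be the Jordan algebra with product $$(x,m_1,m_2)\bullet(x',m_1',m_2')=\big(xx',\;x\cdot m_1'+x'\cdot m_1+m_1m_1',\;x\cdot m_2'+x'\cdot m_2+m_2m_2'\big).$$ Then $J(M_1,M_2)$ has rank $r$, and its adjoint is given by $$(x,m_1,m_2)^\#=\big(x^\#,\,m_1^{\#x},\,m_2^{\#x}\big),$$ where $m_i^{\#x}$ denotes the $M_i$-component of the adjoint $(x,m_i)^\#$ computed in $J_i$ and $x^\#$ is the adjoint of $x\in J$ relative to the norm $N$.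
   Context: A Jordan algebra is a commutative complex algebra satisfying $x^2(xy)=x(x^2y)$; it has a unity unless explicitly said to be non-unital. It is power-associative. The rank of a unital Jordan algebra $A$ is the dimension of the subalgebra generated by the unity $e$ and a general element $x$. If $A$ has rank $r$, a general element satisfies a generic minimal equation $x^r-\sigma_1(x)x^{r-1}+\cdots+(-1)^r\sigma_r(x)e=0$ with $\sigma_j\in\mathrm{Sym}^j(A^* )$; the generic norm is $N=\sigma_r$, the generic trace is $T=\sigma_1$, and the adjoint is $x^\#=(-1)^{r-1}\big(x^{r-1}-\sigma_1(x)x^{r-2}+\cdots+(-1)^{r-1}\sigma_{r-1}(x)e\big)$, so that $x\,x^\#=N(x)e$ (for $r=3$: $x^\#=x^2-T(x)x+S(x)e$ with $S=\sigma_2$). For the form $N$ on $J$ in the claim, "norm" means a homogeneous degree-$r$ form satisfying the usual norm axioms (with $N(e)=1$); these axioms hold automatically for a form that coincides with the restriction to the unital subalgebra $J$ of the generic norm of $J_1$. The adjoint of $x\in J$ relative to $N$ is $x^\#=(-1)^{r-1}\big(x^{r-1}-\sigma_1(x)x^{r-2}+\cdots+(-1)^{r-1}\sigma_{r-1}(x)e\big)$, with $\sigma_j(x)$ defined by $N(te-x)=\sum_{j=0}^r(-1)^j\sigma_j(x)t^{r-j}$ (with $\sigma_0=1$). *)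

theory Defs
  imports "HOL-Analysis.Analysis" "HOL-Computational_Algebra.Computational_Algebra"
begin

section \<open>Complex Jordan algebras\<close>

text \<open>
  An algebra lives on a whole type of class ab\_group\_add; the complex scalar multiplication
  and the product are record fields.
\<close>

record 'a complex_algebra =
  scl :: "complex \<Rightarrow> 'a \<Rightarrow> 'a"
  mul :: "'a \<Rightarrow> 'a \<Rightarrow> 'a"

record 'a unital_complex_algebra = "'a complex_algebra" +
  unity :: 'a

locale jordan_algebra = vector_space "scl A"
  for A :: "('a::ab_group_add, 'z) complex_algebra_scheme" +
  assumes linear_mul: "Vector_Spaces.linear (scl A) (scl A) (mul A x)"
    and mul_commute: "mul A x y = mul A y x"
    and jordan_identity:
      "mul A (mul A x x) (mul A x y) = mul A x (mul A (mul A x x) y)"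

locale unital_jordan_algebra = jordan_algebra A
  for A :: "('a::ab_group_add, 'z) unital_complex_algebra_scheme" +
  assumes unity_mul: "mul A (unity A) x = x"

locale fd_unital_jordan_algebra = unital_jordan_algebra A
  for A :: "('a::ab_group_add, 'z) unital_complex_algebra_scheme" +
  assumes finite_dimensional: "\<exists>B. finite B \<and> span B = UNIV"

primrec alg_power :: "('a, 'z) unital_complex_algebra_scheme \<Rightarrow> 'a \<Rightarrow> nat \<Rightarrow> 'a" where
  "alg_power A x 0 = unity A"
| "alg_power A x (Suc n) = mul A x (alg_power A x n)"

definition subalgebra :: "('a::ab_group_add, 'z) complex_algebra_scheme \<Rightarrow> 'a set \<Rightarrow> bool" where
  "subalgebra A S \<longleftrightarrow> module.subspace (scl A) S \<and> (\<forall>x\<in>S. \<forall>y\<in>S. mul A x y \<in> S)"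


section \<open>Polynomial functions and general elements\<close>

text \<open>
  Elements of the symmetric power of degree \<open>d\<close> of the dual space, seen as functions: linear
  combinations of products of \<open>d\<close> linear forms (over the complex numbers nothing is lost by
  passing to functions). The zero form is obtained from \<open>scale\<close> with \<open>c = 0\<close>.
\<close>

inductive_set Sym_dual :: "(complex \<Rightarrow> 'a::ab_group_add \<Rightarrow> 'a) \<Rightarrow> nat \<Rightarrow> ('a \<Rightarrow> complex) set"
  for s :: "complex \<Rightarrow> 'a::ab_group_add \<Rightarrow> 'a" and d :: nat where
  prod: "(\<And>i. i < d \<Longrightarrow> Vector_Spaces.linear s (*) (l i)) \<Longrightarrow> (\<lambda>x. \<Prod>i<d. l i x) \<in> Sym_dual s d"
| add: "f \<in> Sym_dual s d \<Longrightarrow> g \<in> Sym_dual s d \<Longrightarrow> (\<lambda>x. f x + g x) \<in> Sym_dual s d"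
| scale: "f \<in> Sym_dual s d \<Longrightarrow> (\<lambda>x. c * f x) \<in> Sym_dual s d"

definition polynomial_fun :: "(complex \<Rightarrow> 'a::ab_group_add \<Rightarrow> 'a) \<Rightarrow> ('a \<Rightarrow> complex) \<Rightarrow> bool" where
  "polynomial_fun s p \<longleftrightarrow>
     (\<exists>d f. (\<forall>k\<le>d. f k \<in> Sym_dual s k) \<and> p = (\<lambda>x. \<Sum>k\<le>d. f k x))"

text \<open>\<open>P\<close> holds on a nonempty Zariski-open set (it suffices to consider principal open sets).\<close>

definition generically :: "(complex \<Rightarrow> 'a::ab_group_add \<Rightarrow> 'a) \<Rightarrow> ('a \<Rightarrow> bool) \<Rightarrow> bool" where
  "generically s P \<longleftrightarrow>
     (\<exists>p. polynomial_fun s p \<and> (\<exists>x. p x \<noteq> 0) \<and> (\<forall>x. p x \<noteq> 0 \<longrightarrow> P x))"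


section \<open>Rank, generic norm and adjoint\<close>

definition has_rank ::
  "('a::ab_group_add, 'z) unital_complex_algebra_scheme \<Rightarrow> nat \<Rightarrow> bool" where
  "has_rank A r \<longleftrightarrow>
     generically (scl A) (\<lambda>x. vector_space.dim (scl A) (subalgebra A hull {unity A, x}) = r)"

text \<open>\<open>\<sigma> 0, \<dots>, \<sigma> r\<close> are the coefficients, up to sign, of the generic minimal equation.\<close>

definition generic_minimal_equation ::
  "('a::ab_group_add, 'z) unital_complex_algebra_scheme \<Rightarrow> nat \<Rightarrow> (nat \<Rightarrow> 'a \<Rightarrow> complex) \<Rightarrow> bool"
where
  "generic_minimal_equation A r \<sigma> \<longleftrightarrow>
     has_rank A r \<and>
     (\<forall>j\<le>r. \<sigma> j \<in> Sym_dual (scl A) j) \<and>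
     \<sigma> 0 = (\<lambda>_. 1) \<and>
     generically (scl A)
       (\<lambda>x. (\<Sum>j\<le>r. scl A ((-1) ^ j * \<sigma> j x) (alg_power A x (r - j))) = 0)"

definition adjoint_of_coeffs ::
  "('a::ab_group_add, 'z) unital_complex_algebra_scheme \<Rightarrow> nat \<Rightarrow> (nat \<Rightarrow> 'a \<Rightarrow> complex) \<Rightarrow> 'a \<Rightarrow> 'a"
where
  "adjoint_of_coeffs A r \<sigma> x =
     scl A ((-1) ^ (r - 1)) (\<Sum>j<r. scl A ((-1) ^ j * \<sigma> j x) (alg_power A x (r - 1 - j)))"

text \<open>
  The rank and the generic minimal equation of an algebra are unique, so the following two
  relations determine the generic norm and the adjoint.
\<close>

definition is_generic_norm ::
  "('a::ab_group_add, 'z) unital_complex_algebra_scheme \<Rightarrow> ('a \<Rightarrow> complex) \<Rightarrow> bool" where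
  "is_generic_norm A N \<longleftrightarrow> (\<exists>r \<sigma>. generic_minimal_equation A r \<sigma> \<and> N = \<sigma> r)"

definition is_adjoint ::
  "('a::ab_group_add, 'z) unital_complex_algebra_scheme \<Rightarrow> ('a \<Rightarrow> 'a) \<Rightarrow> bool" where
  "is_adjoint A f \<longleftrightarrow> (\<exists>r \<sigma>. generic_minimal_equation A r \<sigma> \<and> f = adjoint_of_coeffs A r \<sigma>)"

text \<open>
  For a form \<open>N\<close> of degree \<open>r\<close>, the coefficients defined by the expansion of \<open>N(te - x)\<close> in
  powers of \<open>t\<close>; see \<open>norm_coeff_expansion\<close> below.
\<close>

definition norm_coeff ::
  "('a::ab_group_add, 'z) unital_complex_algebra_scheme \<Rightarrow> nat \<Rightarrow> ('a \<Rightarrow> complex)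
     \<Rightarrow> nat \<Rightarrow> 'a \<Rightarrow> complex" where
  "norm_coeff A r N j x =
     (-1) ^ j * coeff (THE p. \<forall>t. poly p t = N (scl A t (unity A) - x)) (r - j)"

definition norm_adjoint ::
  "('a::ab_group_add, 'z) unital_complex_algebra_scheme \<Rightarrow> nat \<Rightarrow> ('a \<Rightarrow> complex) \<Rightarrow> 'a \<Rightarrow> 'a" where
  "norm_adjoint A r N = adjoint_of_coeffs A r (norm_coeff A r N)"

lemma Sym_dual_on_line:
  assumes "N \<in> Sym_dual s r"
  shows "\<exists>p. degree p \<le> r \<and> (\<forall>t. poly p t = N (s t e - x))"
  using assms
proof induction
  case (prod l)
  let ?q = "\<lambda>i. [:- l i x, l i e:]"
  have "poly (?q i) t = l i (s t e - x)" if "i < r" for i t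
  proof -
    interpret Vector_Spaces.linear s "(*)" "l i" using prod that by blast
    show ?thesis by (simp add: diff scale)
  qed
  then have "\<forall>t. poly (\<Prod>i<r. ?q i) t = (\<Prod>i<r. l i (s t e - x))"
    by (simp add: poly_prod)
  moreover have "degree (\<Prod>i<r. ?q i) \<le> (\<Sum>i<r. degree (?q i))"
    using degree_prod_sum_le[of "{..<r}" ?q] by (simp add: o_def)
  moreover have "(\<Sum>i<r. degree (?q i)) \<le> (\<Sum>i<r. 1)"
    by (intro sum_mono) simp
  ultimately show ?case by (intro exI[of _ "\<Prod>i<r. ?q i"]) simp
next
  case (add f g)
  then obtain p q where "degree p \<le> r" "\<forall>t. poly p t = f (s t e - x)"
    "degree q \<le> r" "\<forall>t. poly q t = g (s t e - x)" by blast
  then show ?case by (intro exI[of _ "p + q"]) (simp add: degree_add_le)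
next
  case (scale f c)
  then obtain p where "degree p \<le> r" "\<forall>t. poly p t = f (s t e - x)" by blast
  then show ?case by (intro exI[of _ "smult c p"]) (simp add: degree_smult_le order_trans)
qed

lemma norm_coeff_expansion:
  assumes N: "N \<in> Sym_dual (scl A) r"
  shows "N (scl A t (unity A) - x) = (\<Sum>j\<le>r. (-1) ^ j * norm_coeff A r N j x * t ^ (r - j))"
proof -
  obtain p where p: "degree p \<le> r" "\<forall>t. poly p t = N (scl A t (unity A) - x)"
    using Sym_dual_on_line[OF N] by blast
  have "(THE p. \<forall>t. poly p t = N (scl A t (unity A) - x)) = p"
    using p(2) by (intro the_equality) (auto simp: fun_eq_iff simp flip: poly_eq_poly_eq_iff)
  then have "(\<Sum>j\<le>r. (-1) ^ j * norm_coeff A r N j x * t ^ (r - j)) =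
      (\<Sum>j\<le>r. coeff p (r - j) * t ^ (r - j))"
    by (simp add: norm_coeff_def flip: mult.assoc power_add)
  also have "\<dots> = (\<Sum>j\<le>r. coeff p j * t ^ j)"
    by (rule sum.reindex_bij_witness[of _ "\<lambda>j. r - j" "\<lambda>j. r - j"]) auto
  also have "\<dots> = poly p t"
    unfolding poly_altdef using p(1)
    by (intro sum.mono_neutral_right) (auto simp: coeff_eq_0)
  finally show ?thesis using p(2) by simp
qed


section \<open>The algebras \<open>J \<oplus> M\<close> and \<open>J(M\<^sub>1, M\<^sub>2)\<close>\<close>

definition bilinear_action ::
  "('a::ab_group_add, 'y) complex_algebra_scheme \<Rightarrow> ('b::ab_group_add, 'z) complex_algebra_scheme
     \<Rightarrow> ('a \<Rightarrow> 'b \<Rightarrow> 'b) \<Rightarrow> bool" where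
  "bilinear_action J M act \<longleftrightarrow>
     (\<forall>x. Vector_Spaces.linear (scl M) (scl M) (\<lambda>m. act x m)) \<and>
     (\<forall>m. Vector_Spaces.linear (scl J) (scl M) (\<lambda>x. act x m))"

definition extension ::
  "('a::ab_group_add, 'y) unital_complex_algebra_scheme \<Rightarrow> ('b::ab_group_add, 'z) complex_algebra_scheme
     \<Rightarrow> ('a \<Rightarrow> 'b \<Rightarrow> 'b) \<Rightarrow> ('a \<times> 'b) unital_complex_algebra" where
  "extension J M act =
     \<lparr>scl = module_prod.scale (scl J) (scl M),
      mul = (\<lambda>(x, m) (x', m'). (mul J x x', act x m' + act x' m + mul M m m')),
      unity = (unity J, 0)\<rparr>"

definition joint_extension ::
  "('a::ab_group_add, 'x) unital_complex_algebra_scheme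
     \<Rightarrow> ('b::ab_group_add, 'y) complex_algebra_scheme \<Rightarrow> ('a \<Rightarrow> 'b \<Rightarrow> 'b)
     \<Rightarrow> ('c::ab_group_add, 'z) complex_algebra_scheme \<Rightarrow> ('a \<Rightarrow> 'c \<Rightarrow> 'c)
     \<Rightarrow> ('a \<times> 'b \<times> 'c) unital_complex_algebra" where
  "joint_extension J M1 act1 M2 act2 =
     \<lparr>scl = module_prod.scale (scl J) (module_prod.scale (scl M1) (scl M2)),
      mul = (\<lambda>(x, m1, m2) (x', m1', m2').
               (mul J x x',
                act1 x m1' + act1 x' m1 + mul M1 m1 m1',
                act2 x m2' + act2 x' m2 + mul M2 m2 m2')),
      unity = (unity J, 0, 0)\<rparr>"

lemma jordan_joint_extension:
  fixes J :: "('a::ab_group_add, 'x) unital_complex_algebra_scheme"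
    and M1 :: "('b::ab_group_add, 'y) complex_algebra_scheme"
    and M2 :: "('c::ab_group_add, 'z) complex_algebra_scheme"
  assumes "unital_jordan_algebra (extension J M1 act1)"
    and "unital_jordan_algebra (extension J M2 act2)"
    and "jordan_algebra J" and "jordan_algebra M1" and "jordan_algebra M2"
  shows "unital_jordan_algebra (joint_extension J M1 act1 M2 act2)"
proof -
  interpret E1: unital_jordan_algebra "extension J M1 act1" by fact
  interpret E2: unital_jordan_algebra "extension J M2 act2" by fact
  interpret J: jordan_algebra J by fact
  interpret M1: jordan_algebra M1 by fact
  interpret M2: jordan_algebra M2 by fact
  interpret M: vector_space_prod "scl M1" "scl M2" by unfold_locales
  interpret P: vector_space_prod "scl J" M.scale by unfold_locales
  interpret P1: vector_space_prod "scl J" "scl M1" by unfold_locales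
  interpret P2: vector_space_prod "scl J" "scl M2" by unfold_locales
  let ?A = "joint_extension J M1 act1 M2 act2"
  let ?p1 = "\<lambda>u :: 'a \<times> 'b \<times> 'c. (fst u, fst (snd u))"
  let ?p2 = "\<lambda>u :: 'a \<times> 'b \<times> 'c. (fst u, snd (snd u))"
  have eqI: "u = v" if "?p1 u = ?p1 v" "?p2 u = ?p2 v" for u v
    using that by (auto simp: prod_eq_iff)
  have mul1: "?p1 (mul ?A u v) = mul (extension J M1 act1) (?p1 u) (?p1 v)" for u v
    by (simp add: joint_extension_def extension_def case_prod_unfold)
  have mul2: "?p2 (mul ?A u v) = mul (extension J M2 act2) (?p2 u) (?p2 v)" for u v
    by (simp add: joint_extension_def extension_def case_prod_unfold)
  have scl1: "?p1 (scl ?A c u) = scl (extension J M1 act1) c (?p1 u)" for c u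
    by (simp add: joint_extension_def extension_def P.scale_def M.scale_def P1.scale_def)
  have scl2: "?p2 (scl ?A c u) = scl (extension J M2 act2) c (?p2 u)" for c u
    by (simp add: joint_extension_def extension_def P.scale_def M.scale_def P2.scale_def)
  have one1: "?p1 (unity ?A) = unity (extension J M1 act1)"
    and one2: "?p2 (unity ?A) = unity (extension J M2 act2)"
    by (simp_all add: joint_extension_def extension_def)
  have add1: "?p1 (u + v) = ?p1 u + ?p1 v" and add2: "?p2 (u + v) = ?p2 u + ?p2 v" for u v
    by simp_all
  interpret A: vector_space "scl ?A"
    using P.p.vector_space_axioms by (simp add: joint_extension_def)
  have "Vector_Spaces.linear (scl ?A) (scl ?A) (mul ?A u)" for u
  proof -
    interpret L1: Vector_Spaces.linear "scl (extension J M1 act1)" "scl (extension J M1 act1)"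
      "mul (extension J M1 act1) (?p1 u)" by (rule E1.linear_mul)
    interpret L2: Vector_Spaces.linear "scl (extension J M2 act2)" "scl (extension J M2 act2)"
      "mul (extension J M2 act2) (?p2 u)" by (rule E2.linear_mul)
    show ?thesis
    proof
      show "mul ?A u (v + w) = mul ?A u v + mul ?A u w" for v w
        by (rule eqI) (simp_all only: mul1 mul2 add1 add2 L1.add L2.add)
      show "mul ?A u (scl ?A c v) = scl ?A c (mul ?A u v)" for c v
        by (rule eqI) (simp_all only: mul1 mul2 scl1 scl2 L1.scale L2.scale)
    qed
  qed
  moreover have "mul ?A u v = mul ?A v u" for u v
    by (rule eqI) (simp_all only: mul1 mul2 E1.mul_commute[of "?p1 u"] E2.mul_commute[of "?p2 u"])
  moreover have "mul ?A (mul ?A u u) (mul ?A u v) = mul ?A u (mul ?A (mul ?A u u) v)" for u v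
    by (rule eqI) (simp_all only: mul1 mul2 E1.jordan_identity E2.jordan_identity)
  moreover have "mul ?A (unity ?A) u = u" for u
    by (rule eqI) (simp_all only: mul1 mul2 one1 one2 E1.unity_mul E2.unity_mul)
  ultimately show ?thesis
    by (intro unital_jordan_algebra.intro jordan_algebra.intro jordan_algebra_axioms.intro
        unital_jordan_algebra_axioms.intro A.vector_space_axioms)
qed

end

theory Submission
  imports Defs
begin

text \<open>
  An element of \<open>J(M\<^sub>1, M\<^sub>2)\<close> is determined by its images under the two projections to
  \<open>J\<^sub>1\<close> and \<open>J\<^sub>2\<close>, which are homomorphisms. Comparing the minimal polynomials of \<open>x\<close> and
  \<open>te - x\<close> shows that the generic minimal polynomial of \<open>J\<^sub>i\<close> at \<open>(x, m\<^sub>i)\<close> is \<open>N\<^sub>i(te - (x, m\<^sub>i)) =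
  N(te - x)\<close>. So both projections of an element are annihilated by the same polynomial of degree
  \<open>r\<close>, which therefore annihilates the element itself; the rank cannot be smaller because the
  projection to \<open>J\<^sub>1\<close> is surjective.
\<close>

section \<open>Power associativity\<close>

context jordan_algebra
begin

abbreviation prod_op (infixl "\<odot>" 70) where "prod_op \<equiv> mul A"
abbreviation scl_op (infixr "\<cdot>" 75) where "scl_op \<equiv> scl A"

lemma mul_add_right: "x \<odot> (y + z) = x \<odot> y + x \<odot> z"
  using linear_mul[of x] by (simp add: Vector_Spaces.linear_iff)

lemma mul_scl_right: "x \<odot> (c \<cdot> y) = c \<cdot> (x \<odot> y)"
  using linear_mul[of x] by (simp add: Vector_Spaces.linear_iff)

lemma mul_add_left: "(x + y) \<odot> z = x \<odot> z + y \<odot> z"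
  by (metis mul_add_right mul_commute)

lemma mul_scl_left: "(c \<cdot> x) \<odot> y = c \<cdot> (x \<odot> y)"
  by (metis mul_scl_right mul_commute)

lemma mul_zero_right: "x \<odot> 0 = 0"
  using mul_add_right[of x 0 0] by simp

lemma mul_zero_left: "0 \<odot> x = 0"
  by (metis mul_zero_right mul_commute)

lemma mul_minus_right: "x \<odot> (- y) = - (x \<odot> y)"
  by (metis add.right_inverse minus_unique mul_add_right mul_zero_right)

lemma mul_diff_right: "x \<odot> (y - z) = x \<odot> y - x \<odot> z"
  by (metis diff_conv_add_uminus mul_add_right mul_minus_right)

lemma mul_diff_left: "(x - y) \<odot> z = x \<odot> z - y \<odot> z"
  by (metis mul_diff_right mul_commute)

lemmas mul_distribs = mul_add_right mul_add_left mul_diff_right mul_diff_left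

lemma double_eq_0: "v + v = 0 \<Longrightarrow> v = (0::'a)"
proof -
  assume "v + v = 0"
  then have "2 \<cdot> v = 0"
    by (metis one_add_one scale_left_distrib scale_one)
  then show ?thesis by simp
qed

text \<open>Polarization of the Jordan identity in the element that occurs cubically. It is done by
  hand in two stages, and each stage ends with a division by 2.\<close>

lemma jordan_identity_linearized:
  "(a \<odot> b) \<odot> (c \<odot> y) + (b \<odot> c) \<odot> (a \<odot> y) + (c \<odot> a) \<odot> (b \<odot> y) =
   c \<odot> ((a \<odot> b) \<odot> y) + a \<odot> ((b \<odot> c) \<odot> y) + b \<odot> ((c \<odot> a) \<odot> y)"
proof -
  \<comment> \<open>The defect of the Jordan identity with the three occurrences of x made
    independent: trilinear, symmetric in the first two arguments only, and zero on the diagonal by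
    \<open>cube\<close>.\<close>
  define B where "B p q s = (p \<odot> q) \<odot> (s \<odot> y) - s \<odot> ((p \<odot> q) \<odot> y)" for p q s
  have add: "B (p + p') q s = B p q s + B p' q s" "B q (p + p') s = B q p s + B q p' s"
    "B q s (p + p') = B q s p + B q s p'" for p p' q s
    unfolding B_def by (simp_all add: mul_distribs algebra_simps)
  have diff: "B (p - p') q s = B p q s - B p' q s" "B q (p - p') s = B q p s - B q p' s"
    "B q s (p - p') = B q s p - B q s p'" for p p' q s
    unfolding B_def by (simp_all add: mul_distribs algebra_simps)
  have comm: "B p q s = B q p s" for p q s
    unfolding B_def by (simp add: mul_commute[of p])
  have cube: "B p p p = 0" for p
    unfolding B_def using jordan_identity[of p y] by simp
  \<comment> \<open>In the expansion of the cube of p + q, \<open>?h\<close> collects the terms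
    quadratic in p and \<open>?k\<close> those quadratic in q. Replacing q by -q gives a second
    relation, which separates the two.\<close>
  have quad: "B p q p + B p q p + B p p q = 0" for p q
  proof -
    let ?h = "B p q p + B p q p + B p p q" and ?k = "B q p q + B q p q + B q q p"
    have "?h + ?k = B (p + q) (p + q) (p + q) - B p p p - B q q q"
      by (simp add: add comm[of q p] algebra_simps)
    then have 1: "?h + ?k = 0" by (simp add: cube)
    have "?k - ?h = B (p - q) (p - q) (p - q) - B p p p + B q q q"
      by (simp add: diff comm[of q p] algebra_simps)
    then have "?h = ?k" by (simp add: cube)
    with 1 show ?thesis by (metis double_eq_0)
  qed
  \<comment> \<open>Twice \<open>?v\<close> is the mixed part of \<open>quad\<close> when its
    quadratic argument is a + c.\<close>
  let ?v = "B a b c + B b c a + B c a b"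
  have "?v + ?v = (B (a + c) b (a + c) + B (a + c) b (a + c) + B (a + c) (a + c) b)
      - (B a b a + B a b a + B a a b) - (B c b c + B c b c + B c c b)"
    by (simp add: add comm[of c a] comm[of c b] comm[of b a] algebra_simps)
  then have "?v + ?v = 0" by (simp add: quad)
  then have "?v = 0" by (rule double_eq_0)
  then show ?thesis unfolding B_def by (simp add: algebra_simps)
qed

text \<open>
  In the linearized identity, the left-hand side is symmetric in \<open>a, b, c, y\<close>, so on the right-hand
  side \<open>y\<close> may be exchanged with \<open>a\<close>; reading the result as an identity of operators on \<open>a\<close> gives
  this reduction of multiplication by \<open>(b \<odot> x) \<odot> x\<close>.
\<close>

lemma mul_by_nested_product:
  "((b \<odot> x) \<odot> x) \<odot> a =
     x \<odot> ((b \<odot> x) \<odot> a) + x \<odot> ((b \<odot> x) \<odot> a) + b \<odot> ((x \<odot> x) \<odot> a)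
     - b \<odot> (x \<odot> (x \<odot> a)) - x \<odot> (x \<odot> (b \<odot> a))"
proof -
  have "x \<odot> ((a \<odot> b) \<odot> x) + a \<odot> ((b \<odot> x) \<odot> x) + b \<odot> ((x \<odot> a) \<odot> x) =
      (a \<odot> b) \<odot> (x \<odot> x) + (b \<odot> x) \<odot> (a \<odot> x) + (x \<odot> a) \<odot> (b \<odot> x)"
    by (rule jordan_identity_linearized[symmetric])
  also have "\<dots> = (x \<odot> b) \<odot> (x \<odot> a) + (b \<odot> x) \<odot> (x \<odot> a) + (x \<odot> x) \<odot> (b \<odot> a)"
    by (simp add: mul_commute add_ac)
  also have "\<dots> = x \<odot> ((x \<odot> b) \<odot> a) + x \<odot> ((b \<odot> x) \<odot> a) + b \<odot> ((x \<odot> x) \<odot> a)"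
    by (rule jordan_identity_linearized)
  finally have "a \<odot> ((b \<odot> x) \<odot> x) = x \<odot> ((x \<odot> b) \<odot> a) + x \<odot> ((b \<odot> x) \<odot> a) + b \<odot> ((x \<odot> x) \<odot> a)
      - b \<odot> ((x \<odot> a) \<odot> x) - x \<odot> ((a \<odot> b) \<odot> x)"
    by (simp add: algebra_simps)
  then show ?thesis
    by (simp only: mul_commute[of a "(b \<odot> x) \<odot> x"] mul_commute[of a b] mul_commute[of x b]
        mul_commute[of "x \<odot> a" x] mul_commute[of "b \<odot> a" x])
qed

end

context unital_jordan_algebra
begin

text \<open>By \<open>mul_by_nested_product\<close>, multiplication by the power n + 2 is a
  combination of composites of the multiplications by x, by its square, and by the powers n and n +
  1. Hence the two-step induction, and hence the two commutation claims are proved together.\<close>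

lemma alg_power_mul_commute:
  "alg_power A x n \<odot> (x \<odot> y) = x \<odot> (alg_power A x n \<odot> y) \<and>
   alg_power A x n \<odot> ((x \<odot> x) \<odot> y) = (x \<odot> x) \<odot> (alg_power A x n \<odot> y)"
proof (induction n arbitrary: y rule: induct_nat_012)
  case 0
  then show ?case by (simp add: unity_mul)
next
  case 1
  then show ?case by (simp add: mul_commute[of x "unity A"] unity_mul jordan_identity)
next
  case (ge2 n)
  let ?b = "alg_power A x n"
  have pow: "alg_power A x (Suc (Suc n)) = (?b \<odot> x) \<odot> x" "alg_power A x (Suc n) = ?b \<odot> x"
    by (simp_all add: mul_commute)
  show ?case
    using ge2 unfolding pow
    by (simp add: mul_by_nested_product mul_distribs jordan_identity)
qed

text \<open>Power associativity: the commutation just proved pulls the outer factor x out of the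
  second power.\<close>

lemma alg_power_add: "alg_power A x m \<odot> alg_power A x n = alg_power A x (m + n)"
proof (induction n)
  case 0
  then show ?case by (simp add: unity_mul mul_commute[of _ "unity A"])
next
  case (Suc n)
  then show ?case by (simp add: alg_power_mul_commute)
qed

lemma subalgebra_span_powers: "subalgebra A (span (range (alg_power A x)))"
  (is "subalgebra A ?S")
proof -
  have pow: "alg_power A x m \<odot> v \<in> ?S" if "v \<in> ?S" for m v
    using that
  proof (induction rule: span_induct_alt)
    case base
    then show ?case by (simp add: mul_zero_right span_zero)
  next
    case (step c u v)
    then obtain n where "u = alg_power A x n" by auto
    with step show ?case
      by (auto simp: mul_add_right mul_scl_right alg_power_add intro!: span_add span_scale
          intro: span_base)
  qed
  have "u \<odot> v \<in> ?S" if "u \<in> ?S" "v \<in> ?S" for u v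
    using that(1)
  proof (induction rule: span_induct_alt)
    case base
    then show ?case by (simp add: mul_zero_left span_zero)
  next
    case (step c w u)
    with that(2) show ?case
      by (auto simp: mul_add_left mul_scl_left intro!: span_add span_scale pow)
  qed
  then show ?thesis by (simp add: subalgebra_def)
qed

lemma alg_power_in_subalgebra:
  assumes "subalgebra A S" "unity A \<in> S" "x \<in> S"
  shows "alg_power A x n \<in> S"
  using assms by (induction n) (auto simp: subalgebra_def)

text \<open>This reduces the rank to linear dependence among the powers of one element, hence to
  annihilating polynomials.\<close>

lemma subalgebra_hull_eq_span_powers:
  "subalgebra A hull {unity A, x} = span (range (alg_power A x))"
proof (rule hull_unique)
  have "alg_power A x 0 \<in> span (range (alg_power A x))"
    "alg_power A x (Suc 0) \<in> span (range (alg_power A x))"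
    by (blast intro: span_base)+
  then show "{unity A, x} \<subseteq> span (range (alg_power A x))"
    by (simp add: mul_commute[of x] unity_mul)
next
  fix S assume "{unity A, x} \<subseteq> S" "subalgebra A S"
  then show "span (range (alg_power A x)) \<subseteq> S"
    by (intro span_minimal) (auto simp: subalgebra_def intro: alg_power_in_subalgebra)
qed (rule subalgebra_span_powers)

end

section \<open>Functions that are polynomial on every line\<close>

text \<open>A weak, basis-free form of being polynomial. It is easily closed under sums, products
  and powers in the algebra, and it suffices for density arguments. Every affine line has the form
  tb - a, which is chosen to match te - x.\<close>

definition regular_on_lines ::
  "(complex \<Rightarrow> 'a::ab_group_add \<Rightarrow> 'a) \<Rightarrow> ('a \<Rightarrow> complex) \<Rightarrow> bool" where
  "regular_on_lines s f \<longleftrightarrow> (\<forall>a b. \<exists>p. \<forall>t. f (s t b - a) = poly p t)"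

lemma regular_on_lines_const: "regular_on_lines s (\<lambda>_. c)"
  unfolding regular_on_lines_def
proof (intro allI)
  show "\<exists>p. \<forall>t. c = poly p t" by (rule exI[of _ "[:c:]"]) simp
qed

lemma regular_on_lines_add:
  assumes "regular_on_lines s f" "regular_on_lines s g"
  shows "regular_on_lines s (\<lambda>x. f x + g x)"
  unfolding regular_on_lines_def
proof (intro allI)
  fix a b
  obtain p q where "\<forall>t. f (s t b - a) = poly p t" "\<forall>t. g (s t b - a) = poly q t"
    using assms unfolding regular_on_lines_def by meson
  then show "\<exists>p. \<forall>t. f (s t b - a) + g (s t b - a) = poly p t"
    by (intro exI[of _ "p + q"]) simp
qed

lemma regular_on_lines_mult:
  assumes "regular_on_lines s f" "regular_on_lines s g"
  shows "regular_on_lines s (\<lambda>x. f x * g x)"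
  unfolding regular_on_lines_def
proof (intro allI)
  fix a b
  obtain p q where "\<forall>t. f (s t b - a) = poly p t" "\<forall>t. g (s t b - a) = poly q t"
    using assms unfolding regular_on_lines_def by meson
  then show "\<exists>p. \<forall>t. f (s t b - a) * g (s t b - a) = poly p t"
    by (intro exI[of _ "p * q"]) simp
qed

lemma regular_on_lines_diff:
  assumes "regular_on_lines s f" "regular_on_lines s g"
  shows "regular_on_lines s (\<lambda>x. f x - g x)"
  using regular_on_lines_add[OF assms(1) regular_on_lines_mult[OF regular_on_lines_const[of s "-1"] assms(2)]]
  by simp

lemma regular_on_lines_sum:
  assumes "\<And>i. i \<in> I \<Longrightarrow> regular_on_lines s (f i)"
  shows "regular_on_lines s (\<lambda>x. \<Sum>i\<in>I. f i x)"
  using assms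
  by (induction I rule: infinite_finite_induct)
    (simp_all add: regular_on_lines_const regular_on_lines_add)

lemma regular_on_lines_Sym_dual: "f \<in> Sym_dual s d \<Longrightarrow> regular_on_lines s f"
  unfolding regular_on_lines_def by (metis Sym_dual_on_line)

lemma regular_on_lines_polynomial_fun: "polynomial_fun s p \<Longrightarrow> regular_on_lines s p"
  unfolding polynomial_fun_def
  by (elim exE conjE) (auto intro!: regular_on_lines_sum intro: regular_on_lines_Sym_dual)

section \<open>Density of nonempty principal open sets\<close>

text \<open>On the line joining x to a point where p does not vanish, the product of p and f is the
  zero polynomial while p is not. So f vanishes on the whole line.\<close>

lemma generically_eq_0:
  assumes "vector_space s" and f: "regular_on_lines s f" and gen: "generically s (\<lambda>x. f x = 0)"
  shows "f x = 0"
proof -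
  interpret vector_space s by fact
  obtain p x0 where p: "polynomial_fun s p" "p x0 \<noteq> 0" "\<And>x. p x \<noteq> 0 \<Longrightarrow> f x = 0"
    using gen unfolding generically_def by blast
  \<comment> \<open>The line is at x for t = 0 and at \<open>x0\<close> for t = 1.\<close>
  let ?y = "\<lambda>t. s t (x0 - x) - (- x)"
  obtain P where P: "\<And>t. p (?y t) = poly P t"
    using regular_on_lines_polynomial_fun[OF p(1)] unfolding regular_on_lines_def by blast
  obtain Q where Q: "\<And>t. f (?y t) = poly Q t"
    using f unfolding regular_on_lines_def by blast
  have "poly (P * Q) t = 0" for t
    using p(3)[of "?y t"] P[of t] Q[of t] by auto
  then have "P * Q = 0" using poly_all_0_iff_0 by blast
  moreover have "poly P 1 \<noteq> 0" using P[of 1] p(2) by simp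
  ultimately have "Q = 0" by auto
  then show ?thesis using Q[of 0] by simp
qed

text \<open>Irreducibility of the affine space: if the two open sets were disjoint, q would vanish
  wherever p does not, hence everywhere.\<close>

lemma generically_conj_witness:
  assumes "vector_space s" and P: "generically s P" and Q: "generically s Q"
  shows "\<exists>x. P x \<and> Q x"
proof (rule ccontr)
  assume neg: "\<not> ?thesis"
  obtain p where p: "polynomial_fun s p" "\<exists>x. p x \<noteq> 0" "\<And>x. p x \<noteq> 0 \<Longrightarrow> P x"
    using P unfolding generically_def by blast
  obtain q x0 where q: "polynomial_fun s q" "q x0 \<noteq> 0" "\<And>x. q x \<noteq> 0 \<Longrightarrow> Q x"
    using Q unfolding generically_def by blast
  have "q x0 = 0"
  proof (rule generically_eq_0[OF \<open>vector_space s\<close>])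
    show "regular_on_lines s q" using q(1) by (rule regular_on_lines_polynomial_fun)
    show "generically s (\<lambda>x. q x = 0)"
      unfolding generically_def using p q(3) neg by blast
  qed
  with q(2) show False ..
qed

lemma generically_mono: "generically s P \<Longrightarrow> (\<And>x. P x \<Longrightarrow> Q x) \<Longrightarrow> generically s Q"
  unfolding generically_def by blast

lemma generically_UNIV: "(\<And>x. P x) \<Longrightarrow> generically s P"
proof -
  assume P: "\<And>x. P x"
  have "(\<lambda>_. 1) \<in> Sym_dual s 0"
    using Sym_dual.prod[of 0 s undefined] by simp
  then have "polynomial_fun s (\<lambda>_. 1)"
    unfolding polynomial_fun_def by (intro exI[of _ 0] exI[of _ "\<lambda>_ _. 1"]) simp
  with P show ?thesis unfolding generically_def by (intro exI[of _ "\<lambda>_. 1"]) auto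
qed

section \<open>Pullback along linear maps\<close>

lemma Sym_dual_comp_linear:
  assumes f: "f \<in> Sym_dual s d" and h: "Vector_Spaces.linear s' s h"
  shows "(\<lambda>x. f (h x)) \<in> Sym_dual s' d"
  using f
proof induction
  case (prod l)
  show ?case
    using Sym_dual.prod[of d s' "\<lambda>i. l i \<circ> h"] Vector_Spaces.linear_compose[OF h prod]
    by simp
qed (auto intro: Sym_dual.intros)

lemma polynomial_fun_comp_linear:
  assumes p: "polynomial_fun s p" and h: "Vector_Spaces.linear s' s h"
  shows "polynomial_fun s' (\<lambda>x. p (h x))"
proof -
  obtain d f where f: "\<And>k. k \<le> d \<Longrightarrow> f k \<in> Sym_dual s k" "p = (\<lambda>x. \<Sum>k\<le>d. f k x)"
    using p unfolding polynomial_fun_def by blast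
  show ?thesis
    unfolding polynomial_fun_def f(2)
    by (intro exI[of _ d] exI[of _ "\<lambda>k x. f k (h x)"]) (auto intro: Sym_dual_comp_linear[OF f(1) h])
qed

text \<open>Surjectivity keeps the pulled-back polynomial from being identically zero.\<close>

lemma generically_comp_linear:
  assumes "generically s P" and h: "Vector_Spaces.linear s' s h" and "surj h"
  shows "generically s' (\<lambda>x. P (h x))"
proof -
  obtain p y where p: "polynomial_fun s p" "p y \<noteq> 0" "\<And>x. p x \<noteq> 0 \<Longrightarrow> P x"
    using assms(1) unfolding generically_def by blast
  moreover obtain x where "y = h x" using \<open>surj h\<close> by (rule surjE)
  ultimately show ?thesis
    unfolding generically_def
    by (intro exI[of _ "\<lambda>x. p (h x)"]) (auto intro: polynomial_fun_comp_linear[OF _ h])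
qed

text \<open>Linear forms reduce vector identities to scalar ones, to which
  \<open>generically_eq_0\<close> applies.\<close>

lemma (in vector_space) ex_linear_form_neq_0:
  assumes "v \<noteq> 0"
  shows "\<exists>\<phi>. Vector_Spaces.linear scale (*) \<phi> \<and> \<phi> v \<noteq> 0"
proof -
  interpret vector_space_pair scale "(*) :: 'a \<Rightarrow> 'a \<Rightarrow> 'a"
    by unfold_locales (auto simp: algebra_simps)
  have "independent {v}" using assms by simp
  from linear_independent_extend[OF this, of "\<lambda>_. 1"] show ?thesis by auto
qed

section \<open>Evaluating polynomials at an element\<close>

definition alg_eval ::
  "('a::ab_group_add, 'z) unital_complex_algebra_scheme \<Rightarrow> complex poly \<Rightarrow> 'a \<Rightarrow> 'a" where
  "alg_eval A q x = (\<Sum>i\<le>degree q. scl A (coeff q i) (alg_power A x i))"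

context unital_jordan_algebra
begin

lemma mul_sum_right: "x \<odot> (\<Sum>i\<in>I. f i) = (\<Sum>i\<in>I. x \<odot> f i)"
  by (induction I rule: infinite_finite_induct) (simp_all add: mul_zero_right mul_add_right)

lemma alg_eval_bound:
  assumes "degree q \<le> n"
  shows "alg_eval A q x = (\<Sum>i\<le>n. coeff q i \<cdot> alg_power A x i)"
  unfolding alg_eval_def using assms
  by (intro sum.mono_neutral_left) (auto simp: coeff_eq_0)

lemma alg_eval_0: "alg_eval A 0 x = 0"
  by (simp add: alg_eval_def)

lemma alg_eval_add: "alg_eval A (p + q) x = alg_eval A p x + alg_eval A q x"
  using degree_add_le_max[of p q]
  by (simp add: alg_eval_bound[of _ "max (degree p) (degree q)"] scale_left_distrib sum.distrib)

lemma alg_eval_smult: "alg_eval A (smult c q) x = c \<cdot> alg_eval A q x"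
  by (simp add: alg_eval_bound[of _ "degree q"] scale_sum_right)

lemma alg_eval_diff: "alg_eval A (p - q) x = alg_eval A p x - alg_eval A q x"
  using alg_eval_add[of p "smult (-1) q" x] alg_eval_smult[of "-1" q x] by simp

lemma alg_eval_sum: "alg_eval A (\<Sum>i\<in>I. f i) x = (\<Sum>i\<in>I. alg_eval A (f i) x)"
  by (induction I rule: infinite_finite_induct) (simp_all add: alg_eval_0 alg_eval_add)

lemma alg_eval_monom: "alg_eval A (monom c n) x = c \<cdot> alg_power A x n"
proof -
  have "alg_eval A (monom c n) x = (\<Sum>i\<le>n. coeff (monom c n) i \<cdot> alg_power A x i)"
    by (rule alg_eval_bound) (rule degree_monom_le)
  also have "\<dots> = (\<Sum>i\<le>n. if n = i then c \<cdot> alg_power A x i else 0)"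
    by (intro sum.cong) auto
  finally show ?thesis by simp
qed

lemma alg_eval_pCons: "alg_eval A (pCons a q) x = a \<cdot> unity A + x \<odot> alg_eval A q x"
proof -
  have "alg_eval A (pCons a q) x = (\<Sum>i\<le>Suc (degree q). coeff (pCons a q) i \<cdot> alg_power A x i)"
    by (rule alg_eval_bound) (rule degree_pCons_le)
  then show ?thesis
    by (simp add: sum.atMost_Suc_shift alg_eval_def mul_sum_right mul_scl_right
        del: sum.atMost_Suc)
qed

text \<open>Horner's scheme: each step splits off a factor t - X, which acts as multiplication by te
  - x. Annihilating polynomials of te - x thereby become annihilating polynomials of x.\<close>

lemma alg_eval_pcompose_reflect:
  "alg_eval A (pcompose q [:t, -1:]) x = alg_eval A q (t \<cdot> unity A - x)"
proof (induction q)
  case 0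
  then show ?case by (simp add: alg_eval_0)
next
  case (pCons a q)
  have "pcompose (pCons a q) [:t, -1:] =
      [:a:] + (smult t (pcompose q [:t, -1:]) - pCons 0 (pcompose q [:t, -1:]))"
    by (simp add: pcompose_pCons)
  then show ?case
    by (simp only: alg_eval_add alg_eval_diff alg_eval_smult alg_eval_pCons alg_eval_0 pCons.IH)
      (simp add: mul_diff_left mul_scl_left unity_mul mul_zero_right)
qed

section \<open>Annihilating polynomials and dimension\<close>

text \<open>The relation expresses the power of exponent \<open>degree q\<close> by lower ones, so
  the span of the lower powers is stable under multiplication by x.\<close>

lemma hull_subset_span_powers:
  assumes "q \<noteq> 0" and root: "alg_eval A q x = 0"
  shows "subalgebra A hull {unity A, x} \<subseteq> span (alg_power A x ` {..<degree q})"
proof -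
  define d where "d = degree q"
  let ?B = "alg_power A x ` {..<d}"
  have top: "alg_power A x d \<in> span ?B"
  proof -
    have "coeff q d \<cdot> alg_power A x d = - (\<Sum>i<d. coeff q i \<cdot> alg_power A x i)"
      using root unfolding alg_eval_def d_def[symmetric]
      by (simp add: lessThan_Suc_atMost[symmetric] add_eq_0_iff)
    then have "coeff q d \<cdot> alg_power A x d \<in> span ?B"
      by (auto intro!: span_neg span_sum span_scale intro: span_base)
    moreover have "coeff q d \<noteq> 0" using \<open>q \<noteq> 0\<close> by (simp add: d_def)
    ultimately show ?thesis using span_scale[of "coeff q d \<cdot> alg_power A x d" ?B "inverse (coeff q d)"]
      by simp
  qed
  have step: "x \<odot> v \<in> span ?B" if "v \<in> span ?B" for v
    using that
  proof (induction rule: span_induct_alt)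
    case base
    then show ?case by (simp add: mul_zero_right span_zero)
  next
    case (step c u v)
    then obtain i where i: "i < d" "u = alg_power A x i" by auto
    have "alg_power A x (Suc i) \<in> span ?B"
      using top i(1) by (cases "Suc i = d") (auto intro!: span_base simp del: alg_power.simps)
    with step i show ?case
      by (auto simp: mul_add_right mul_scl_right intro!: span_add span_scale)
  qed
  have "alg_power A x n \<in> span ?B" for n
  proof (induction n)
    case 0
    \<comment> \<open>If d = 0, then \<open>top\<close> itself is the claim: q is a nonzero constant
      and the unity lies in the zero span.\<close>
    show ?case using top by (cases "d = 0") (auto intro!: span_base simp del: alg_power.simps)
  next
    case (Suc n)
    then show ?case by (simp add: step)
  qed
  then show ?thesis
    unfolding subalgebra_hull_eq_span_powers d_def[symmetric] by (intro span_minimal) auto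
qed

lemma dim_hull_le_degree:
  assumes "q \<noteq> 0" and "alg_eval A q x = 0"
  shows "dim (subalgebra A hull {unity A, x}) \<le> degree q"
  using dim_le_card[OF hull_subset_span_powers[OF assms]]
    card_image_le[of "{..<degree q}" "alg_power A x"] by simp

text \<open>The leading terms cancel in p - q. A nonzero difference would annihilate x in degree
  below r and force a smaller dimension.\<close>

lemma annihilating_poly_unique:
  assumes "dim (subalgebra A hull {unity A, x}) = r"
    and "degree p \<le> r" "coeff p r = 1" "alg_eval A p x = 0"
    and "degree q \<le> r" "coeff q r = 1" "alg_eval A q x = 0"
  shows "p = q"
proof (rule ccontr)
  assume "p \<noteq> q"
  then have "p - q \<noteq> 0" by simp
  moreover have "degree (p - q) \<le> r" using assms by (simp add: degree_diff_le)
  moreover have "coeff (p - q) r = 0" using assms by simp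
  ultimately have "degree (p - q) < r"
    by (metis leading_coeff_0_iff order_le_less)
  moreover have "r \<le> degree (p - q)"
    using dim_hull_le_degree[OF \<open>p - q \<noteq> 0\<close>, of x] assms by (simp add: alg_eval_diff)
  ultimately show False by simp
qed

lemma has_rank_unique: "has_rank A r \<Longrightarrow> has_rank A r' \<Longrightarrow> r = r'"
  unfolding has_rank_def using generically_conj_witness[OF vector_space_axioms] by blast

text \<open>The form \<phi> is generalized in the induction because composing it with multiplication
  by a or by b gives new linear forms.\<close>

lemma regular_on_lines_alg_power:
  assumes "Vector_Spaces.linear scl_op (*) \<phi>"
  shows "regular_on_lines scl_op (\<lambda>x. \<phi> (alg_power A x n))"
  using assms
proof (induction n arbitrary: \<phi>)
  case 0
  then show ?case by (simp add: regular_on_lines_const)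
next
  case (Suc n)
  interpret \<phi>: Vector_Spaces.linear scl_op "(*)" \<phi> by fact
  show ?case
    unfolding regular_on_lines_def
  proof (intro allI)
    fix a b
    have comp: "Vector_Spaces.linear scl_op (*) (\<lambda>v. \<phi> (c \<odot> v))" for c
      using Vector_Spaces.linear_compose[OF linear_mul Suc.prems, of c] by (simp add: o_def)
    obtain p where p: "\<And>t. \<phi> (b \<odot> alg_power A (t \<cdot> b - a) n) = poly p t"
      using Suc.IH[OF comp[of b]] unfolding regular_on_lines_def by blast
    obtain q where q: "\<And>t. \<phi> (a \<odot> alg_power A (t \<cdot> b - a) n) = poly q t"
      using Suc.IH[OF comp[of a]] unfolding regular_on_lines_def by blast
    show "\<exists>p. \<forall>t. \<phi> (alg_power A (t \<cdot> b - a) (Suc n)) = poly p t"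
      by (rule exI[of _ "[:0, 1:] * p - q"])
        (simp add: mul_diff_left mul_scl_left \<phi>.diff \<phi>.scale p q)
  qed
qed

end

section \<open>The generic minimal polynomial\<close>

text \<open>For \<open>c j = \<sigma> j x\<close> this is the generic minimal polynomial at x, with
  the alternating signs built in.\<close>

definition signed_poly :: "nat \<Rightarrow> (nat \<Rightarrow> complex) \<Rightarrow> complex poly" where
  "signed_poly r c = (\<Sum>j\<le>r. monom ((-1) ^ j * c j) (r - j))"

lemma signed_poly_cong: "(\<And>j. j \<le> r \<Longrightarrow> c j = d j) \<Longrightarrow> signed_poly r c = signed_poly r d"
  by (simp add: signed_poly_def)

lemma degree_signed_poly: "degree (signed_poly r c) \<le> r"
  unfolding signed_poly_def
  by (intro degree_sum_le) (auto intro: order_trans[OF degree_monom_le])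

lemma coeff_signed_poly: "j \<le> r \<Longrightarrow> coeff (signed_poly r c) (r - j) = (-1) ^ j * c j"
proof -
  assume j: "j \<le> r"
  have "coeff (signed_poly r c) (r - j) = (\<Sum>i\<le>r. if j = i then (-1) ^ i * c i else 0)"
    unfolding signed_poly_def coeff_sum using j by (intro sum.cong) auto
  then show ?thesis using j by simp
qed

lemma coeff_signed_poly_top: "coeff (signed_poly r c) r = c 0"
  using coeff_signed_poly[of 0 r c] by simp

lemma poly_signed_poly_0: "poly (signed_poly r c) 0 = (-1) ^ r * c r"
  using coeff_signed_poly[of r r c] by (simp add: poly_0_coeff_0)

lemma poly_signed_poly: "poly (signed_poly r c) t = (\<Sum>j\<le>r. (-1) ^ j * c j * t ^ (r - j))"
  by (simp add: signed_poly_def poly_sum poly_monom)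

context unital_jordan_algebra
begin

lemma alg_eval_signed_poly:
  "alg_eval A (signed_poly r c) x = (\<Sum>j\<le>r. ((-1) ^ j * c j) \<cdot> alg_power A x (r - j))"
  by (simp add: signed_poly_def alg_eval_sum alg_eval_monom)

text \<open>After applying a linear form, the left-hand side is regular on lines and vanishes
  generically, hence everywhere.\<close>

lemma generic_minimal_equation_everywhere:
  assumes "generic_minimal_equation A r \<sigma>"
  shows "alg_eval A (signed_poly r (\<lambda>j. \<sigma> j x)) x = 0"
proof (rule ccontr)
  let ?F = "\<lambda>x. alg_eval A (signed_poly r (\<lambda>j. \<sigma> j x)) x"
  assume "?F x \<noteq> 0"
  then obtain \<phi> where \<phi>: "Vector_Spaces.linear scl_op (*) \<phi>" "\<phi> (?F x) \<noteq> 0"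
    using ex_linear_form_neq_0 by blast
  interpret \<phi>: Vector_Spaces.linear scl_op "(*)" \<phi> by fact
  have F: "\<phi> (?F x) = (\<Sum>j\<le>r. (-1) ^ j * \<sigma> j x * \<phi> (alg_power A x (r - j)))" for x
    by (simp add: alg_eval_signed_poly \<phi>.sum \<phi>.scale)
  have "\<phi> (?F x) = 0"
  proof (rule generically_eq_0[OF vector_space_axioms, where f = "\<lambda>x. \<phi> (?F x)"])
    show "regular_on_lines scl_op (\<lambda>x. \<phi> (?F x))"
      unfolding F using assms \<phi>(1) unfolding generic_minimal_equation_def
      by (intro regular_on_lines_sum regular_on_lines_mult regular_on_lines_const
          regular_on_lines_alg_power) (auto intro: regular_on_lines_Sym_dual)
    show "generically scl_op (\<lambda>x. \<phi> (?F x) = 0)"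
      using assms unfolding generic_minimal_equation_def alg_eval_signed_poly
      by (auto elim!: generically_mono)
  qed
  with \<phi>(2) show False ..
qed

text \<open>Where the generated subalgebra has dimension r, both choices give the unique monic
  annihilator of degree r. Density extends the equality to all points.\<close>

lemma generic_minimal_equation_unique:
  assumes gme: "generic_minimal_equation A r \<sigma>" and gme': "generic_minimal_equation A r \<sigma>'"
    and "j \<le> r"
  shows "\<sigma> j x = \<sigma>' j x"
proof -
  let ?p = "\<lambda>x. signed_poly r (\<lambda>j. \<sigma> j x)" and ?p' = "\<lambda>x. signed_poly r (\<lambda>j. \<sigma>' j x)"
  have "\<sigma> j x - \<sigma>' j x = 0"
  proof (rule generically_eq_0[OF vector_space_axioms])
    show "regular_on_lines scl_op (\<lambda>x. \<sigma> j x - \<sigma>' j x)"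
      using gme gme' \<open>j \<le> r\<close> unfolding generic_minimal_equation_def
      by (intro regular_on_lines_diff) (auto intro: regular_on_lines_Sym_dual)
    have "has_rank A r" using gme by (simp add: generic_minimal_equation_def)
    then show "generically scl_op (\<lambda>x. \<sigma> j x - \<sigma>' j x = 0)"
      unfolding has_rank_def
    proof (rule generically_mono)
      fix x assume "dim (subalgebra A hull {unity A, x}) = r"
      then have "?p x = ?p' x"
        using gme gme' generic_minimal_equation_everywhere[OF gme]
          generic_minimal_equation_everywhere[OF gme']
        by (intro annihilating_poly_unique[of x r])
          (simp_all add: degree_signed_poly coeff_signed_poly_top generic_minimal_equation_def)
      then have "coeff (?p x) (r - j) = coeff (?p' x) (r - j)" by simp
      then show "\<sigma> j x - \<sigma>' j x = 0"
        using \<open>j \<le> r\<close> by (simp add: coeff_signed_poly)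
    qed
  qed
  then show ?thesis by simp
qed

text \<open>
  If the minimal polynomial of \<open>te - x\<close> is \<open>q\<close>, that of \<open>x\<close> is \<open>(-1)\<^sup>r q(t - X)\<close>; evaluate at \<open>X = t\<close>.
\<close>

lemma generic_norm_shift:
  assumes gme: "generic_minimal_equation A r \<sigma>"
  shows "\<sigma> r (t \<cdot> unity A - x) = poly (signed_poly r (\<lambda>j. \<sigma> j x)) t"
proof -
  let ?p = "\<lambda>x. signed_poly r (\<lambda>j. \<sigma> j x)"
  let ?y = "\<lambda>x. t \<cdot> unity A - x"
  have \<sigma>: "\<sigma> j \<in> Sym_dual scl_op j" if "j \<le> r" for j
    using gme that by (simp add: generic_minimal_equation_def)
  have \<sigma>0: "\<sigma> 0 x = 1" for x
    using gme by (simp add: generic_minimal_equation_def)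
  have "\<sigma> r (?y x) - poly (?p x) t = 0"
  proof (rule generically_eq_0[OF vector_space_axioms])
    have "regular_on_lines scl_op (\<lambda>x. \<sigma> r (?y x))"
      unfolding regular_on_lines_def
    proof (intro allI)
      fix a b
      \<comment> \<open>The reflection sends ub - a to u(-b) - (-(te + a)), and
        \<open>?y (- a)\<close> is te + a. So lines go to lines.\<close>
      obtain p where p: "\<And>u. \<sigma> r (u \<cdot> (- b) - (- ?y (- a))) = poly p u"
        using regular_on_lines_Sym_dual[OF \<sigma>[of r]] unfolding regular_on_lines_def by blast
      have "?y (u \<cdot> b - a) = u \<cdot> (- b) - (- ?y (- a))" for u
        by (simp add: algebra_simps)
      then show "\<exists>p. \<forall>u. \<sigma> r (?y (u \<cdot> b - a)) = poly p u"
        using p by metis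
    qed
    then show "regular_on_lines scl_op (\<lambda>x. \<sigma> r (?y x) - poly (?p x) t)"
      unfolding poly_signed_poly
      by (intro regular_on_lines_diff regular_on_lines_sum regular_on_lines_mult
          regular_on_lines_const) (auto intro: regular_on_lines_Sym_dual[OF \<sigma>])
    have "has_rank A r" using gme by (simp add: generic_minimal_equation_def)
    then show "generically scl_op (\<lambda>x. \<sigma> r (?y x) - poly (?p x) t = 0)"
      unfolding has_rank_def
    proof (rule generically_mono)
      fix x assume dim: "dim (subalgebra A hull {unity A, x}) = r"
      define q where "q = pcompose (?p (?y x)) [:t, -1:]"
      \<comment> \<open>The degree is exactly r because \<sigma> 0 is 1; therefore q has degree r
        and leading coefficient \<open>(-1) ^ r\<close>.\<close>
      have deg: "degree (?p (?y x)) = r"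
        using degree_signed_poly[of r "\<lambda>j. \<sigma> j (?y x)"] le_degree[of "?p (?y x)" r]
        by (simp add: coeff_signed_poly_top \<sigma>0)
      then have "degree q = r" unfolding q_def by (simp add: degree_pcompose)
      moreover have "lead_coeff q = (-1) ^ r"
        unfolding q_def using deg by (subst lead_coeff_comp) (simp_all add: coeff_signed_poly_top \<sigma>0)
      moreover have "alg_eval A q x = 0"
        unfolding q_def alg_eval_pcompose_reflect by (rule generic_minimal_equation_everywhere[OF gme])
      ultimately have "?p x = smult ((-1) ^ r) q"
        using generic_minimal_equation_everywhere[OF gme, of x]
        by (intro annihilating_poly_unique[OF dim])
          (simp_all add: degree_signed_poly coeff_signed_poly_top \<sigma>0 alg_eval_smult
            flip: power_mult_distrib)
      \<comment> \<open>At t the inner polynomial of q vanishes, leaving the constant term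
        \<open>(-1) ^ r * \<sigma> r (?y x)\<close>; the two signs cancel.\<close>
      then have "poly (?p x) t = (-1) ^ r * poly (?p (?y x)) 0"
        by (simp add: q_def poly_pcompose)
      then show "\<sigma> r (?y x) - poly (?p x) t = 0"
        by (simp add: poly_signed_poly_0 flip: mult.assoc power_mult_distrib)
    qed
  qed
  then show ?thesis by simp
qed

end

text \<open>A complex polynomial is determined by its values, so \<open>signed_poly r c\<close> is
  the one selected in \<open>norm_coeff\<close>.\<close>

lemma norm_coeff_eq:
  assumes "\<And>t. N (scl A t (unity A) - x) = poly (signed_poly r c) t" "j \<le> r"
  shows "norm_coeff A r N j x = c j"
proof -
  have "(THE p. \<forall>t. poly p t = N (scl A t (unity A) - x)) = signed_poly r c"
    using assms(1) by (intro the_equality) (auto simp: fun_eq_iff simp flip: poly_eq_poly_eq_iff)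
  with \<open>j \<le> r\<close> show ?thesis
    by (simp add: norm_coeff_def coeff_signed_poly flip: mult.assoc power_mult_distrib)
qed

section \<open>Homomorphisms\<close>

locale unital_algebra_hom = A: unital_jordan_algebra A + B: unital_jordan_algebra B
  for A :: "('a::ab_group_add, 'y) unital_complex_algebra_scheme"
    and B :: "('b::ab_group_add, 'z) unital_complex_algebra_scheme" +
  fixes f :: "'a \<Rightarrow> 'b"
  assumes linear: "Vector_Spaces.linear (scl A) (scl B) f"
    and hom_mul: "f (mul A x y) = mul B (f x) (f y)"
    and hom_unity: "f (unity A) = unity B"
begin

sublocale Vector_Spaces.linear "scl A" "scl B" f
  by (rule linear)

lemma hom_alg_power: "f (alg_power A x n) = alg_power B (f x) n"
  by (induction n) (simp_all add: hom_unity hom_mul)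

lemma hom_alg_eval: "f (alg_eval A q x) = alg_eval B q (f x)"
  by (simp add: alg_eval_def sum scale hom_alg_power)

lemma hom_adjoint_of_coeffs:
  assumes "\<And>j. j < r \<Longrightarrow> \<sigma> j x = \<tau> j (f x)"
  shows "f (adjoint_of_coeffs A r \<sigma> x) = adjoint_of_coeffs B r \<tau> (f x)"
  using assms by (simp add: adjoint_of_coeffs_def sum scale hom_alg_power)

text \<open>The map f carries the subalgebra generated by x onto the one generated by its image. The
  finite W makes the chosen basis finite, so that cardinalities compare as dimensions.\<close>

lemma dim_hull_image_le:
  assumes "finite W" "subalgebra A hull {unity A, x} \<subseteq> A.span W"
  shows "B.dim (subalgebra B hull {unity B, f x}) \<le> A.dim (subalgebra A hull {unity A, x})"
    (is "B.dim ?HB \<le> A.dim ?HA")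
proof -
  obtain X where X: "X \<subseteq> ?HA" "A.independent X" "?HA \<subseteq> A.span X" "card X = A.dim ?HA"
    by (rule A.basis_exists)
  have "finite X"
    using A.independent_span_bound[of W X] X(1,2) assms by blast
  have "range (alg_power B (f x)) = f ` range (alg_power A x)"
    by (auto simp: hom_alg_power image_image)
  then have "?HB = f ` ?HA"
    by (simp add: A.subalgebra_hull_eq_span_powers B.subalgebra_hull_eq_span_powers span_image)
  also have "\<dots> \<subseteq> B.span (f ` X)"
    using X(3) by (auto simp: span_image)
  finally have "B.dim ?HB \<le> card (f ` X)"
    using \<open>finite X\<close> by (intro B.dim_le_card) auto
  also have "\<dots> \<le> A.dim ?HA"
    using card_image_le[OF \<open>finite X\<close>, of f] X(4) by simp
  finally show ?thesis .
qed

end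

section \<open>Extensions of \<open>J\<close>\<close>

lemma scl_extension:
  assumes "vector_space (scl J)" "vector_space (scl M)"
  shows "scl (extension J M act) c u = (scl J c (fst u), scl M c (snd u))"
proof -
  interpret J: vector_space "scl J" by fact
  interpret M: vector_space "scl M" by fact
  interpret vector_space_prod "scl J" "scl M" by unfold_locales
  show ?thesis by (simp add: extension_def scale_def)
qed

lemma scl_joint_extension:
  assumes "vector_space (scl J)" "vector_space (scl M1)" "vector_space (scl M2)"
  shows "scl (joint_extension J M1 act1 M2 act2) c u =
    (scl J c (fst u), scl M1 c (fst (snd u)), scl M2 c (snd (snd u)))"
proof -
  interpret J: vector_space "scl J" by fact
  interpret M1: vector_space "scl M1" by fact
  interpret M2: vector_space "scl M2" by fact
  interpret M: vector_space_prod "scl M1" "scl M2" by unfold_locales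
  interpret vector_space_prod "scl J" M.scale by unfold_locales
  show ?thesis by (simp add: joint_extension_def scale_def M.scale_def)
qed

lemma extension_fst_hom:
  assumes "unital_jordan_algebra J" "jordan_algebra M" "unital_jordan_algebra (extension J M act)"
  shows "unital_algebra_hom (extension J M act) J fst"
proof -
  interpret J: unital_jordan_algebra J by fact
  interpret M: jordan_algebra M by fact
  interpret E: unital_jordan_algebra "extension J M act" by fact
  show ?thesis
    by unfold_locales
      (simp_all add: scl_extension J.vector_space_axioms M.vector_space_axioms,
       simp_all add: extension_def case_prod_unfold)
qed

text \<open>J(M1, M2) is the fibre product of the two extensions over J, and these are its
  projections.\<close>

lemma joint_extension_homs:
  assumes "unital_jordan_algebra J" "jordan_algebra M1" "jordan_algebra M2"
    and "unital_jordan_algebra (extension J M1 act1)"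
    and "unital_jordan_algebra (extension J M2 act2)"
  shows "unital_algebra_hom (joint_extension J M1 act1 M2 act2) (extension J M1 act1)
           (\<lambda>u. (fst u, fst (snd u)))" (is ?hom1)
    and "unital_algebra_hom (joint_extension J M1 act1 M2 act2) (extension J M2 act2)
           (\<lambda>u. (fst u, snd (snd u)))" (is ?hom2)
proof -
  interpret J: unital_jordan_algebra J by fact
  interpret M1: jordan_algebra M1 by fact
  interpret M2: jordan_algebra M2 by fact
  interpret E1: unital_jordan_algebra "extension J M1 act1" by fact
  interpret E2: unital_jordan_algebra "extension J M2 act2" by fact
  interpret A: unital_jordan_algebra "joint_extension J M1 act1 M2 act2"
    by (intro jordan_joint_extension J.jordan_algebra_axioms) fact+
  note vs = J.vector_space_axioms M1.vector_space_axioms M2.vector_space_axioms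
  show ?hom1
    by unfold_locales
      (simp_all add: scl_extension scl_joint_extension vs,
       simp_all add: extension_def joint_extension_def case_prod_unfold)
  show ?hom2
    by unfold_locales
      (simp_all add: scl_extension scl_joint_extension vs,
       simp_all add: extension_def joint_extension_def case_prod_unfold)
qed

text \<open>By \<open>generic_norm_shift\<close>, the coefficients at (x, m) are those of the
  generic norm at te - (x, m), which depends on te - x alone.\<close>

lemma extension_generic_coeffs:
  fixes J :: "('a::ab_group_add, 'x) unital_complex_algebra_scheme"
    and M :: "('b::ab_group_add, 'y) complex_algebra_scheme"
    and act :: "'a \<Rightarrow> 'b \<Rightarrow> 'b"
  defines "E \<equiv> extension J M act"
  assumes "vector_space (scl J)" "vector_space (scl M)" "unital_jordan_algebra E"
    and rank: "has_rank E r" and norm: "is_generic_norm E N'"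
    and N: "\<And>x m. N x = N' (x, m)" and adj: "is_adjoint E adj"
  obtains \<sigma> where "generic_minimal_equation E r \<sigma>"
    and "\<And>j x m. j \<le> r \<Longrightarrow> \<sigma> j (x, m) = norm_coeff J r N j x"
    and "adj = adjoint_of_coeffs E r \<sigma>"
proof -
  interpret E: unital_jordan_algebra E by fact
  have deg: "r' = r" if "generic_minimal_equation E r' \<sigma>'" for r' \<sigma>'
    using that rank E.has_rank_unique by (simp add: generic_minimal_equation_def)
  obtain \<sigma> where \<sigma>: "generic_minimal_equation E r \<sigma>" "adj = adjoint_of_coeffs E r \<sigma>"
    using adj deg unfolding is_adjoint_def by blast
  \<comment> \<open>The norm and the adjoint may come with different coefficient families;
    uniqueness identifies them up to index r.\<close>
  obtain \<sigma>' where \<sigma>': "generic_minimal_equation E r \<sigma>'" "N' = \<sigma>' r"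
    using norm deg unfolding is_generic_norm_def by blast
  have N: "N x = \<sigma> r (x, m)" for x m
    using N[of x m] \<sigma>'(2) E.generic_minimal_equation_unique[OF \<sigma>(1) \<sigma>'(1)] by simp
  have "\<sigma> j (x, m) = norm_coeff J r N j x" if "j \<le> r" for j x m
  proof (rule norm_coeff_eq[symmetric])
    fix t
    have "scl E t (unity E) - (x, m) = (scl J t (unity J) - x, scl M t 0 - m)"
      unfolding E_def scl_extension[OF assms(2,3)] by (simp add: extension_def)
    then show "N (scl J t (unity J) - x) = poly (signed_poly r (\<lambda>j. \<sigma> j (x, m))) t"
      using E.generic_norm_shift[OF \<sigma>(1), of t "(x, m)"] N by simp
  qed fact
  with \<sigma> that show thesis by blast
qed

theorem proposition2p1:
  fixes J :: "'a::ab_group_add unital_complex_algebra"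
    and M1 :: "'b::ab_group_add complex_algebra" and act1 :: "'a \<Rightarrow> 'b \<Rightarrow> 'b"
    and M2 :: "'c::ab_group_add complex_algebra" and act2 :: "'a \<Rightarrow> 'c \<Rightarrow> 'c"
    and r :: nat
    and N :: "'a \<Rightarrow> complex"
    and N1 :: "'a \<times> 'b \<Rightarrow> complex" and N2 :: "'a \<times> 'c \<Rightarrow> complex"
    and adj1 :: "'a \<times> 'b \<Rightarrow> 'a \<times> 'b" and adj2 :: "'a \<times> 'c \<Rightarrow> 'a \<times> 'c"
  assumes "fd_unital_jordan_algebra J"
    and "jordan_algebra M1" and "jordan_algebra M2"
    and "bilinear_action J M1 act1" and "bilinear_action J M2 act2"
    and "fd_unital_jordan_algebra (extension J M1 act1)"
    and "fd_unital_jordan_algebra (extension J M2 act2)"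
    and "has_rank (extension J M1 act1) r" and "has_rank (extension J M2 act2) r"
    and "is_generic_norm (extension J M1 act1) N1" and "is_generic_norm (extension J M2 act2) N2"
    and "N \<in> Sym_dual (scl J) r" and "N (unity J) = 1"
    and "\<forall>x m1 m2. N x = N1 (x, m1) \<and> N x = N2 (x, m2)"
    and "is_adjoint (extension J M1 act1) adj1" and "is_adjoint (extension J M2 act2) adj2"
  shows "has_rank (joint_extension J M1 act1 M2 act2) r \<and>
         is_adjoint (joint_extension J M1 act1 M2 act2)
           (\<lambda>(x, m1, m2). (norm_adjoint J r N x, snd (adj1 (x, m1)), snd (adj2 (x, m2))))"
proof -
  let ?E1 = "extension J M1 act1" and ?E2 = "extension J M2 act2"
  let ?A = "joint_extension J M1 act1 M2 act2"
  let ?p1 = "\<lambda>u :: 'a \<times> 'b \<times> 'c. (fst u, fst (snd u))"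
  let ?p2 = "\<lambda>u :: 'a \<times> 'b \<times> 'c. (fst u, snd (snd u))"
  interpret J: fd_unital_jordan_algebra J by fact
  interpret M1: jordan_algebra M1 by fact
  interpret M2: jordan_algebra M2 by fact
  interpret E1: fd_unital_jordan_algebra ?E1 by fact
  interpret E2: fd_unital_jordan_algebra ?E2 by fact
  note algs = J.unital_jordan_algebra_axioms M1.jordan_algebra_axioms M2.jordan_algebra_axioms
    E1.unital_jordan_algebra_axioms E2.unital_jordan_algebra_axioms
  interpret p1: unital_algebra_hom ?A ?E1 ?p1 by (rule joint_extension_homs[OF algs])
  interpret p2: unital_algebra_hom ?A ?E2 ?p2 by (rule joint_extension_homs[OF algs])
  interpret q: unital_algebra_hom ?E1 J fst by (rule extension_fst_hom[OF algs(1,2,4)])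
  have eqI: "u = v" if "?p1 u = ?p1 v" "?p2 u = ?p2 v" for u v
    using that by (auto simp: prod_eq_iff)
  have N1: "N x = N1 (x, m)" for x m
    using assms(14) by simp
  obtain \<sigma> where \<sigma>: "generic_minimal_equation ?E1 r \<sigma>"
    and \<sigma>_eq: "\<And>j x m. j \<le> r \<Longrightarrow> \<sigma> j (x, m) = norm_coeff J r N j x"
    and adj1: "adj1 = adjoint_of_coeffs ?E1 r \<sigma>"
    by (rule extension_generic_coeffs[OF J.vector_space_axioms M1.vector_space_axioms
          E1.unital_jordan_algebra_axioms assms(8,10) N1 assms(15)]) (rule that)
  have N2: "N x = N2 (x, m)" for x m
    using assms(14) by simp
  obtain \<tau> where \<tau>: "generic_minimal_equation ?E2 r \<tau>"
    and \<tau>_eq: "\<And>j x m. j \<le> r \<Longrightarrow> \<tau> j (x, m) = norm_coeff J r N j x"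
    and adj2: "adj2 = adjoint_of_coeffs ?E2 r \<tau>"
    by (rule extension_generic_coeffs[OF J.vector_space_axioms M2.vector_space_axioms
          E2.unital_jordan_algebra_axioms assms(9,11) N2 assms(16)]) (rule that)
  \<comment> \<open>Coefficients pulled back from the first extension. By
    \<open>\<rho>\<tau>\<close> they are also those pulled back from the second, since both are norm
    coefficients of the J-component.\<close>
  define \<rho> where "\<rho> j u = \<sigma> j (?p1 u)" for j u
  have \<rho>\<tau>: "\<rho> j u = \<tau> j (?p2 u)" if "j \<le> r" for j u
    using that by (simp add: \<rho>_def \<sigma>_eq \<tau>_eq)
  let ?P = "\<lambda>u. signed_poly r (\<lambda>j. \<rho> j u)"
  have zero: "alg_eval ?A (?P u) u = 0" for u
  proof (rule eqI)
    have "?p1 (alg_eval ?A (?P u) u) = 0"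
      unfolding p1.hom_alg_eval \<rho>_def by (rule E1.generic_minimal_equation_everywhere[OF \<sigma>])
    then show "?p1 (alg_eval ?A (?P u) u) = ?p1 0" by (simp add: zero_prod_def)
    have "?P u = signed_poly r (\<lambda>j. \<tau> j (?p2 u))"
      by (rule signed_poly_cong) (rule \<rho>\<tau>)
    then have "?p2 (alg_eval ?A (?P u) u) = 0"
      unfolding p2.hom_alg_eval
      using E2.generic_minimal_equation_everywhere[OF \<tau>, of "?p2 u"] by simp
    then show "?p2 (alg_eval ?A (?P u) u) = ?p2 0" by (simp add: zero_prod_def)
  qed
  have \<rho>0: "\<rho> 0 = (\<lambda>_. 1)"
    using \<sigma> by (auto simp: \<rho>_def generic_minimal_equation_def)
  then have "?P u \<noteq> 0" for u
    using coeff_signed_poly_top[of r "\<lambda>j. \<rho> j u"] by auto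
  note P = this zero
  have rank: "has_rank ?A r"
    unfolding has_rank_def
  proof (rule generically_mono)
    \<comment> \<open>The first projection is onto, so a generic element of the joint algebra has a
      generic image in the first extension.\<close>
    show "generically (scl ?A)
        (\<lambda>u. E1.dim (subalgebra ?E1 hull {unity ?E1, ?p1 u}) = r)"
      using \<open>has_rank ?E1 r\<close> p1.linear unfolding has_rank_def
      by (rule generically_comp_linear) (auto simp: surj_def)
  next
    fix u assume dim: "E1.dim (subalgebra ?E1 hull {unity ?E1, ?p1 u}) = r"
    have "p1.A.dim (subalgebra ?A hull {unity ?A, u}) \<le> r"
      using p1.A.dim_hull_le_degree[OF P] degree_signed_poly order_trans by blast
    \<comment> \<open>Projecting cannot raise the dimension. The annihilating polynomial also
      supplies the finite spanning set.\<close>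
    moreover have "r \<le> p1.A.dim (subalgebra ?A hull {unity ?A, u})"
      using p1.dim_hull_image_le[OF finite_imageI[OF finite_lessThan]
          p1.A.hull_subset_span_powers[OF P], of u] unfolding dim .
    ultimately show "p1.A.dim (subalgebra ?A hull {unity ?A, u}) = r" by simp
  qed
  have "generic_minimal_equation ?A r \<rho>"
    unfolding generic_minimal_equation_def
  proof (intro conjI allI impI)
    show "\<rho> j \<in> Sym_dual (scl ?A) j" if "j \<le> r" for j
      unfolding \<rho>_def using \<sigma> that
      by (intro Sym_dual_comp_linear[OF _ p1.linear]) (simp add: generic_minimal_equation_def)
    show "generically (scl ?A)
        (\<lambda>u. (\<Sum>j\<le>r. scl ?A ((- 1) ^ j * \<rho> j u) (alg_power ?A u (r - j))) = 0)"
      using zero by (intro generically_UNIV) (simp add: p1.A.alg_eval_signed_poly)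
  qed (fact rank \<rho>0)+
  moreover have "adjoint_of_coeffs ?A r \<rho> =
      (\<lambda>(x, m1, m2). (norm_adjoint J r N x, snd (adj1 (x, m1)), snd (adj2 (x, m2))))"
  proof
    fix u :: "'a \<times> 'b \<times> 'c"
    have 1: "?p1 (adjoint_of_coeffs ?A r \<rho> u) = adj1 (?p1 u)"
      unfolding adj1 by (rule p1.hom_adjoint_of_coeffs) (simp add: \<rho>_def)
    \<comment> \<open>Adjoints involve only indices below r, where the two families agree.\<close>
    have 2: "?p2 (adjoint_of_coeffs ?A r \<rho> u) = adj2 (?p2 u)"
      unfolding adj2 by (rule p2.hom_adjoint_of_coeffs) (simp add: \<rho>\<tau>)
    \<comment> \<open>The adjoint of the first extension is pushed down to J, where its coefficients
      become the norm coefficients.\<close>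
    have 3: "fst (adj1 (?p1 u)) = norm_adjoint J r N (fst u)"
      unfolding adj1 norm_adjoint_def
      using q.hom_adjoint_of_coeffs[of r \<sigma> "?p1 u" "norm_coeff J r N"] by (simp add: \<sigma>_eq)
    show "adjoint_of_coeffs ?A r \<rho> u =
        (\<lambda>(x, m1, m2). (norm_adjoint J r N x, snd (adj1 (x, m1)), snd (adj2 (x, m2)))) u"
      using 1 2 3 by (auto simp: prod_eq_iff case_prod_unfold)
  qed
  ultimately show ?thesis
    using rank unfolding is_adjoint_def by (intro conjI exI[of _ r] exI[of _ \<rho>]) simp_all
qed

end
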